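(* Let $q=p^m>4$ be a prime power ($p$ prime) and let $0\le e\le m-1$. If there exists an $[n,k]_q$ GRS code with $l$-dimensional $e$-Galois hull, where $0\le l\le k$, then for any $1\le i\le\min\{l,q+1-n\}$ and each $0\le s\le l-i$ there exists an $[n+i,k+i]_q$ MDS code with $s$-dimensional $e$-Galois hull.
   Context: For $\bm x,\bm y\in\mathbb F_q^n$, the $e$-Galois inner product is $\langle\bm x,\bm y\rangle_e=\sum_{i=1}^n x_iy_i^{p^e}$. For a linear code $\mathcal C\subseteq\mathbb F_q^n$, $\mathcal C^{\perp_e}=\{\bm x\in\mathbb F_q^n:\langle\bm y,\bm x\rangle_e=0\ \text{for all }\bm y\in\mathcal C\}$ and the $e$-Galois hull is $\mathrm{Hull}_e(\mathcal C)=\mathcal C\cap\mathcal C^{\perp_e}$. An $[n,k]_q$ GRS code ($1\le k\le n$) is a code $\{(v_1f(a_1),\dots,v_nf(a_n)):f\in\mathbb F_q[x],\deg f\le k-1\}$ with distinct $a_j\in\mathbb F_q$ and $v_j\in\mathbb F_q^*$. An $[n,k]$ code is MDS if its minimum distance is $n-k+1$. *)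

theory Defs
  imports "Jordan_Normal_Form.VS_Connect"
begin

definition code_dim :: "nat \<Rightarrow> 'a::field vec set \<Rightarrow> nat" where
  "code_dim n C = vectorspace.dim class_ring ((module_vec TYPE('a) n)\<lparr>carrier := C\<rparr>)"

definition linear_code :: "nat \<Rightarrow> nat \<Rightarrow> 'a::field vec set \<Rightarrow> bool" where
  "linear_code n k C \<longleftrightarrow>
     VectorSpace.subspace class_ring C (module_vec TYPE('a) n) \<and> code_dim n C = k"

text \<open>The parameter \<open>p\<close> stands for the characteristic of the field, so that
  \<open>y \<mapsto> y ^ (p ^ e)\<close> is a power of the Frobenius map.\<close>

definition galois_inner :: "nat \<Rightarrow> nat \<Rightarrow> 'a::field vec \<Rightarrow> 'a vec \<Rightarrow> 'a" where
  "galois_inner p e x y = (\<Sum>i<dim_vec x. x $ i * (y $ i) ^ (p ^ e))"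

definition galois_dual :: "nat \<Rightarrow> nat \<Rightarrow> nat \<Rightarrow> 'a::field vec set \<Rightarrow> 'a vec set" where
  "galois_dual p e n C = {x \<in> carrier_vec n. \<forall>y\<in>C. galois_inner p e y x = 0}"

definition galois_hull :: "nat \<Rightarrow> nat \<Rightarrow> nat \<Rightarrow> 'a::field vec set \<Rightarrow> 'a vec set" where
  "galois_hull p e n C = C \<inter> galois_dual p e n C"

text \<open>Since \<open>degree 0 = 0\<close> and \<open>1 \<le> k\<close>, the bound \<open>degree f \<le> k - 1\<close> admits exactly the
  polynomials of degree less than \<open>k\<close>, including the zero polynomial.\<close>

definition grs_code :: "nat \<Rightarrow> nat \<Rightarrow> 'a::field vec set \<Rightarrow> bool" where
  "grs_code n k C \<longleftrightarrow> 1 \<le> k \<and> k \<le> n \<and>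
     (\<exists>a v. inj_on a {..<n} \<and> (\<forall>j<n. v j \<noteq> 0) \<and>
        C = {vec n (\<lambda>j. v j * poly f (a j)) | f. degree f \<le> k - 1})"

definition hamming_dist :: "'a vec \<Rightarrow> 'a vec \<Rightarrow> nat" where
  "hamming_dist x y = card {i. i < dim_vec x \<and> x $ i \<noteq> y $ i}"

text \<open>Meaningful only for codes with at least two words; \<open>Min {}\<close> is unspecified.\<close>

definition min_distance :: "'a vec set \<Rightarrow> nat" where
  "min_distance C = Min {hamming_dist x y | x y. x \<in> C \<and> y \<in> C \<and> x \<noteq> y}"

definition mds_code :: "nat \<Rightarrow> nat \<Rightarrow> 'a::field vec set \<Rightarrow> bool" where
  "mds_code n k C \<longleftrightarrow> linear_code n k C \<and> min_distance C = n - k + 1"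

end

theory Submission
  imports Defs "HOL-Number_Theory.Residues"
begin

text \<open>Add \<open>i - 1\<close> new finite evaluation points and the point at infinity, and let \<open>g\<close> be the monic
  polynomial of degree \<open>i - 1\<close> vanishing at the new finite points. Dividing the old column
  multipliers by \<open>g\<close>, the extended GRS code of dimension \<open>k + i\<close> contains the old code \<open>C\<close> padded by
  zeros, via \<open>f \<mapsto> f * g\<close>. A padded hull vector of \<open>C\<close> lies in the new hull once it satisfies \<open>i\<close>
  semilinear equations, so the new hull has dimension at least \<open>l - i\<close>.

  Rescaling the coordinates by \<open>\<lambda>\<close> preserves the MDS property and turns the Galois form into the
  form with weights \<open>\<mu>\<^sub>j = \<lambda>\<^sub>j ^ (p ^ e + 1)\<close>. Since \<open>q > 4\<close>, these weights can be chosen in \<open>{1, c}\<close>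
  with \<open>c \<noteq> 1\<close>. Changing one weight changes the dimension of the radical by at most one. The
  determinant of the Gram matrix is affine in each weight and nonzero when \<open>\<mu>\<close> is the indicator of an
  information set, so it is nonzero for some \<open>\<mu>\<close> with all entries in \<open>{1, c}\<close>. Hence all
  dimensions between the original one and 0 occur. Dimensions are read off from cardinalities.\<close>

section \<open>Subspaces over finite fields\<close>

text \<open>Coordinates in a finite basis \<open>B\<close> identify the space with the functions
  from \<open>B\<close> to the scalars.\<close>

lemma card_carrier_eq_power_dim:
  assumes vs: "vectorspace K V" and fin: "finite (carrier V)"
  shows "card (carrier V) = card (carrier K) ^ vectorspace.dim K V"
proof -
  have mod: "Module.module K V" using vs by (rule vectorspace.axioms)
  note span = module.span_is_subset2[OF mod, of "carrier V"] vectorspace.span_mem[OF vs, of "carrier V"]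
  have "module.gen_set K V (carrier V)" using span by auto
  with fin have "vectorspace.fin_dim K V" unfolding vectorspace.fin_dim_def[OF vs] by blast
  then obtain B where B: "finite B" "vectorspace.basis K V B"
    using vectorspace.finite_basis_exists[OF vs] by blast
  then have BV: "B \<subseteq> carrier V" unfolding vectorspace.basis_def[OF vs] by blast
  have rep: "\<exists>! a. a \<in> B \<rightarrow>\<^sub>E carrier K \<and> module.lincomb V a B = v" if "v \<in> carrier V" for v
    using vectorspace.basis_criterion[OF vs B(1) BV] B(2) that by blast
  have cl: "module.lincomb V a B \<in> carrier V" if "a \<in> B \<rightarrow>\<^sub>E carrier K" for a
    using that BV by (intro module.lincomb_closed[OF mod]) auto
  have "bij_betw (\<lambda>a. module.lincomb V a B) (B \<rightarrow>\<^sub>E carrier K) (carrier V)"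
    unfolding bij_betw_def inj_on_def using rep cl by blast
  then have "card (carrier V) = card (B \<rightarrow>\<^sub>E carrier K)"
    by (simp add: bij_betw_same_card)
  also have "\<dots> = card (carrier K) ^ card B"
    using B(1) by (simp add: card_PiE)
  finally show ?thesis using vectorspace.dim_basis[OF vs B] by simp
qed

abbreviation vec_subspace :: "nat \<Rightarrow> 'a::field vec set \<Rightarrow> bool" where
  "vec_subspace n C \<equiv> VectorSpace.subspace class_ring C (module_vec TYPE('a) n)"

lemma vec_subspaceI:
  assumes "C \<subseteq> carrier_vec n" "0\<^sub>v n \<in> C"
    "\<And>x y. x \<in> C \<Longrightarrow> y \<in> C \<Longrightarrow> x + y \<in> C"
    "\<And>c x. x \<in> C \<Longrightarrow> c \<cdot>\<^sub>v x \<in> C"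
  shows "vec_subspace n C"
proof (rule subspace.intro[OF vec_vs], rule submodule.intro[OF vec_module])
qed (use assms in \<open>auto simp: module_vec_simps\<close>)

lemma vec_subspaceD:
  assumes "vec_subspace n C"
  shows "C \<subseteq> carrier_vec n" "0\<^sub>v n \<in> C"
    "\<And>x y. x \<in> C \<Longrightarrow> y \<in> C \<Longrightarrow> x + y \<in> C"
    "\<And>c x. x \<in> C \<Longrightarrow> c \<cdot>\<^sub>v x \<in> C"
    "\<And>x y. x \<in> C \<Longrightarrow> y \<in> C \<Longrightarrow> x - y \<in> C"
proof -
  have "submodule class_ring C (module_vec TYPE('a) n)"
    using assms by (rule subspace.submod)
  note sub_axioms = this[unfolded submodule_def module_vec_simps]
  show sub: "C \<subseteq> carrier_vec n" and "0\<^sub>v n \<in> C"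
    and add: "\<And>x y. x \<in> C \<Longrightarrow> y \<in> C \<Longrightarrow> x + y \<in> C"
    and sm: "\<And>c x. x \<in> C \<Longrightarrow> c \<cdot>\<^sub>v x \<in> C"
    using sub_axioms by auto
  show "x - y \<in> C" if "x \<in> C" "y \<in> C" for x y
  proof -
    have "x - y = x + (-1) \<cdot>\<^sub>v y" using that sub by (intro eq_vecI) auto
    then show ?thesis using add sm that by auto
  qed
qed

lemma finite_vec_subspace:
  fixes C :: "'a::{field,finite} vec set"
  assumes "C \<subseteq> carrier_vec n"
  shows "finite C"
proof (rule finite_subset)
  show "C \<subseteq> vec_of_list ` {xs. length xs = n}"
  proof
    fix x assume "x \<in> C"
    then have "x = vec_of_list (list_of_vec x)" "length (list_of_vec x) = n"
      using assms by (auto simp: vec_list carrier_vecD)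
    then show "x \<in> vec_of_list ` {xs. length xs = n}" by blast
  qed
  have "finite {xs :: 'a list. set xs \<subseteq> UNIV \<and> length xs = n}"
    by (rule finite_lists_length_eq) simp
  then show "finite (vec_of_list ` {xs :: 'a list. length xs = n})" by simp
qed

lemma card_vec_subspace:
  fixes C :: "'a::{field,finite} vec set"
  assumes "vec_subspace n C"
  shows "card C = card (UNIV :: 'a set) ^ code_dim n C"
proof -
  have "vectorspace class_ring ((module_vec TYPE('a) n)\<lparr>carrier := C\<rparr>)"
    by (rule vectorspace.subspace_is_vs[OF vec_vs assms])
  from card_carrier_eq_power_dim[OF this] show ?thesis
    using finite_vec_subspace[OF vec_subspaceD(1)[OF assms]] by (simp add: code_dim_def)
qed

lemma one_less_card_field: "1 < card (UNIV :: 'a::{field,finite} set)"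
proof -
  have "card {0, 1 :: 'a} \<le> card (UNIV :: 'a set)" by (rule card_mono) auto
  then show ?thesis by simp
qed

lemma code_dim_eqI:
  fixes C :: "'a::{field,finite} vec set"
  assumes "vec_subspace n C" "card C = card (UNIV :: 'a set) ^ d"
  shows "code_dim n C = d"
  using card_vec_subspace[OF assms(1)] assms(2) one_less_card_field[where 'a='a]
  by (metis power_inject_exp)

text \<open>Subtracting one element of a fibre of \<open>\<phi>\<close> embeds that fibre into the
  zero fibre, and there are at most q fibres. Only additivity is asked of \<open>\<phi>\<close>,
  since the maps to come are semilinear.\<close>

lemma card_le_card_kernel:
  fixes \<phi> :: "'a::{field,finite} vec \<Rightarrow> 'a"
  assumes H: "H \<subseteq> carrier_vec n"
    and minus: "\<And>x y. x \<in> H \<Longrightarrow> y \<in> H \<Longrightarrow> x - y \<in> H"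
    and \<phi>: "\<And>x y. x \<in> H \<Longrightarrow> y \<in> H \<Longrightarrow> \<phi> (x - y) = \<phi> x - \<phi> y"
  shows "card H \<le> card (UNIV :: 'a set) * card {x \<in> H. \<phi> x = 0}"
proof -
  have finH: "finite H" using finite_vec_subspace[OF H] .
  have fibre: "card {x \<in> H. \<phi> x = c} \<le> card {x \<in> H. \<phi> x = 0}" for c
  proof (cases "\<exists>z. z \<in> H \<and> \<phi> z = c")
    case True
    then obtain z where z: "z \<in> H" "\<phi> z = c" by blast
    show ?thesis
    proof (rule card_inj_on_le[where f = "\<lambda>x. x - z"])
      show "inj_on (\<lambda>x. x - z) {x \<in> H. \<phi> x = c}"
      proof (rule inj_onI)
        fix x y assume *: "x \<in> {x \<in> H. \<phi> x = c}" "y \<in> {x \<in> H. \<phi> x = c}" "x - z = y - z"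
        then have c: "x \<in> carrier_vec n" "y \<in> carrier_vec n" "z \<in> carrier_vec n"
          using H z by auto
        show "x = y"
        proof (rule eq_vecI)
          fix i assume "i < dim_vec y"
          with c have "(x - z) $ i = x $ i - z $ i" "(y - z) $ i = y $ i - z $ i" by auto
          then show "x $ i = y $ i" using *(3) by simp
        qed (use c in auto)
      qed
    qed (use z minus \<phi> finH in auto)
  next
    case False
    then have empty: "{x \<in> H. \<phi> x = c} = {}" by blast
    show ?thesis unfolding empty by simp
  qed
  have "H = (\<Union>c\<in>UNIV. {x \<in> H. \<phi> x = c})" by auto
  then have "card H \<le> (\<Sum>c\<in>UNIV. card {x \<in> H. \<phi> x = c})"
    using card_UN_le[of "UNIV :: 'a set" "\<lambda>c. {x \<in> H. \<phi> x = c}"] by auto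
  also have "\<dots> \<le> (\<Sum>c\<in>(UNIV :: 'a set). card {x \<in> H. \<phi> x = 0})"
    by (rule sum_mono) (rule fibre)
  finally show ?thesis by simp
qed

lemma card_le_card_common_kernel:
  fixes \<phi> :: "nat \<Rightarrow> 'a::{field,finite} vec \<Rightarrow> 'a"
  assumes "H \<subseteq> carrier_vec n"
    and "\<And>x y. x \<in> H \<Longrightarrow> y \<in> H \<Longrightarrow> x - y \<in> H"
    and "\<And>t x y. t < m \<Longrightarrow> x \<in> H \<Longrightarrow> y \<in> H \<Longrightarrow> \<phi> t (x - y) = \<phi> t x - \<phi> t y"
  shows "card H \<le> card (UNIV :: 'a set) ^ m * card {x \<in> H. \<forall>t<m. \<phi> t x = 0}"
  using assms
proof (induction m)
  case (Suc m)
  let ?H = "{x \<in> H. \<forall>t<m. \<phi> t x = 0}"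
  have "card H \<le> card (UNIV :: 'a set) ^ m * card ?H"
    using Suc by simp
  also have "card ?H \<le> card (UNIV :: 'a set) * card {x \<in> ?H. \<phi> m x = 0}"
    by (rule card_le_card_kernel[where n = n]) (use Suc.prems in auto)
  also have "{x \<in> ?H. \<phi> m x = 0} = {x \<in> H. \<forall>t<Suc m. \<phi> t x = 0}"
    by (auto simp: less_Suc_eq)
  finally show ?case by (simp add: mult_ac)
qed simp

section \<open>Radicals of weighted Galois forms\<close>

text \<open>The exponent \<open>r\<close> stands for \<open>p ^ e\<close>, and the radical is taken
  in the argument carrying the power, as in \<open>galois_dual\<close>. Weights may be zero, which
  admits indicator weights.\<close>

definition weighted_radical :: "nat \<Rightarrow> nat \<Rightarrow> (nat \<Rightarrow> 'a) \<Rightarrow> 'a::field vec set \<Rightarrow> 'a vec set" where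
  "weighted_radical r n \<mu> C = {x \<in> C. \<forall>y\<in>C. (\<Sum>j<n. \<mu> j * y $ j * (x $ j) ^ r) = 0}"

text \<open>For r = 0 additivity would read 1 = 1 + 1. Positivity is what gives
  \<open>0 ^ r = 0\<close> later.\<close>

lemma exponent_pos:
  assumes frob: "\<And>x y :: 'a::{field,finite}. (x + y) ^ r = x ^ r + y ^ r"
  shows "r > 0"
proof (rule ccontr)
  assume "\<not> r > 0"
  then have "(1 :: 'a) + 0 = 1 + 1" using frob[of 0 0] by simp
  then have "(0 :: 'a) = 1" by (rule add_left_imp_eq)
  then show False by simp
qed

lemma power_diff_r:
  assumes frob: "\<And>x y :: 'a::{field,finite}. (x + y) ^ r = x ^ r + y ^ r"
  shows "(x - y :: 'a) ^ r = x ^ r - y ^ r"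
  using frob[of "x - y" y] by simp

text \<open>The r-th power is additive and vanishes only at 0, hence is injective, hence surjective
  on a finite field.\<close>

lemma ex_root_exponent:
  assumes frob: "\<And>x y :: 'a::{field,finite}. (x + y) ^ r = x ^ r + y ^ r"
  shows "\<exists>y :: 'a. y ^ r = x"
proof -
  have "inj (\<lambda>y :: 'a. y ^ r)"
  proof (rule injI)
    fix x y :: 'a assume "x ^ r = y ^ r"
    then have "(x - y) ^ r = 0" by (simp add: power_diff_r[OF frob])
    then show "x = y" by simp
  qed
  then have "surj (\<lambda>y :: 'a. y ^ r)" by (simp add: finite_UNIV_inj_surj)
  then show ?thesis by (metis surjD)
qed

lemma weighted_sum_diff:
  fixes x x' :: "'a::{field,finite} vec"
  assumes frob: "\<And>x y :: 'a::{field,finite}. (x + y) ^ r = x ^ r + y ^ r"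
    and "x \<in> carrier_vec n" "x' \<in> carrier_vec n"
  shows "(\<Sum>j<n. f j * ((x - x') $ j) ^ r) = (\<Sum>j<n. f j * (x $ j) ^ r) - (\<Sum>j<n. f j * (x' $ j) ^ r)"
  using assms by (simp add: power_diff_r[OF frob] right_diff_distrib sum_subtractf)

lemma weighted_sum_smult:
  fixes x :: "'a::{field,finite} vec"
  assumes "x \<in> carrier_vec n"
  shows "(\<Sum>j<n. f j * ((c \<cdot>\<^sub>v x) $ j) ^ r) = c ^ r * (\<Sum>j<n. f j * (x $ j) ^ r)"
  using assms by (simp add: power_mult_distrib sum_distrib_left mult_ac)

text \<open>The form is additive in \<open>x\<close> and pulls out a scalar \<open>c\<close> as
  \<open>c ^ r\<close>, so its zeros are still closed under scalars.\<close>

lemma vec_subspace_radical: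
  fixes C :: "'a::{field,finite} vec set"
  assumes frob: "\<And>x y :: 'a::{field,finite}. (x + y) ^ r = x ^ r + y ^ r"
    and C: "vec_subspace n C"
  shows "vec_subspace n (weighted_radical r n \<mu> C)"
proof (rule vec_subspaceI)
  note CD = vec_subspaceD[OF C]
  show "0\<^sub>v n \<in> weighted_radical r n \<mu> C"
    using CD exponent_pos[OF frob] by (auto simp: weighted_radical_def)
  show "c \<cdot>\<^sub>v x \<in> weighted_radical r n \<mu> C" if "x \<in> weighted_radical r n \<mu> C" for c x
    using that CD(1,4) weighted_sum_smult[of x n _ c] by (auto simp: weighted_radical_def)
  show "x + x' \<in> weighted_radical r n \<mu> C"
    if "x \<in> weighted_radical r n \<mu> C" "x' \<in> weighted_radical r n \<mu> C" for x x'
  proof -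
    have x: "x \<in> C" "x' \<in> C" "x \<in> carrier_vec n" "x' \<in> carrier_vec n"
      using that CD(1) by (auto simp: weighted_radical_def)
    have "(\<Sum>j<n. f j * ((x + x') $ j) ^ r) = (\<Sum>j<n. f j * (x $ j) ^ r) + (\<Sum>j<n. f j * (x' $ j) ^ r)" for f
      using x by (simp add: frob distrib_left sum.distrib)
    then show ?thesis using that x CD(3) by (auto simp: weighted_radical_def)
  qed
qed (use vec_subspaceD(1)[OF C] in \<open>auto simp: weighted_radical_def\<close>)

section \<open>The effect of changing one weight on the radical\<close>

lemma weighted_sum_upd:
  fixes g :: "nat \<Rightarrow> 'a::field"
  assumes "j < n"
  shows "(\<Sum>i<n. (\<mu>(j := c)) i * g i) = (\<Sum>i<n. \<mu> i * g i) + (c - \<mu> j) * g j"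
proof -
  have "(\<Sum>i<n. (\<mu>(j := c)) i * g i) = c * g j + (\<Sum>i\<in>{..<n} - {j}. \<mu> i * g i)"
    using assms by (subst sum.remove[of _ j]) auto
  moreover have "(\<Sum>i<n. \<mu> i * g i) = \<mu> j * g j + (\<Sum>i\<in>{..<n} - {j}. \<mu> i * g i)"
    using assms by (subst sum.remove[of _ j]) auto
  ultimately show ?thesis by (simp add: algebra_simps)
qed

text \<open>A radical vector with \<open>x $ j = 0\<close> does not see the weight at
  \<open>j\<close> and stays in the radical after the change. Imposing \<open>x $ j = 0\<close>
  costs at most a factor q.\<close>

lemma card_radical_upd:
  fixes C :: "'a::{field,finite} vec set"
  assumes frob: "\<And>x y :: 'a::{field,finite}. (x + y) ^ r = x ^ r + y ^ r"
    and C: "vec_subspace n C" and j: "j < n"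
  shows "card (weighted_radical r n \<mu> C)
    \<le> card (UNIV :: 'a set) * card (weighted_radical r n (\<mu>(j := c)) C)"
proof -
  let ?R = "weighted_radical r n \<mu> C"
  note R = vec_subspaceD[OF vec_subspace_radical[OF frob C, of \<mu>]]
  note R' = vec_subspaceD[OF vec_subspace_radical[OF frob C, of "\<mu>(j := c)"]]
  have "card ?R \<le> card (UNIV :: 'a set) * card {x \<in> ?R. x $ j = 0}"
    by (rule card_le_card_kernel[OF R(1) R(5)]) (use R(1) j in auto)
  also have "{x \<in> ?R. x $ j = 0} \<subseteq> weighted_radical r n (\<mu>(j := c)) C"
    using j exponent_pos[OF frob] weighted_sum_upd[OF j, of \<mu> c "\<lambda>i. y $ i * (x $ i) ^ r" for x y]
    by (auto simp: weighted_radical_def mult.assoc)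
  then have "card {x \<in> ?R. x $ j = 0} \<le> card (weighted_radical r n (\<mu>(j := c)) C)"
    using finite_vec_subspace[OF R'(1)] by (rule card_mono[rotated])
  finally show ?thesis by simp
qed

text \<open>Changing one weight is a rank-one update of the Gram matrix, whose determinant is therefore
  affine in that weight.\<close>

lemma radical_trivial_upd:
  fixes C :: "'a::{field,finite} vec set"
  assumes frob: "\<And>x y :: 'a::{field,finite}. (x + y) ^ r = x ^ r + y ^ r"
    and C: "vec_subspace n C" and j: "j < n" and ab: "a \<noteq> b"
    and triv: "weighted_radical r n \<mu> C = {0\<^sub>v n}"
  shows "weighted_radical r n (\<mu>(j := a)) C = {0\<^sub>v n} \<or>
    weighted_radical r n (\<mu>(j := b)) C = {0\<^sub>v n}"
proof (rule ccontr)
  note CD = vec_subspaceD[OF C]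
  let ?B = "\<lambda>y x. \<Sum>i<n. \<mu> i * y $ i * (x $ i) ^ r"
  \<comment> \<open>Comparing the two forms, a radical vector for the weight \<open>c\<close>
    satisfies \<open>?B y x = (\<mu> j - c) * (y $ j * (x $ j) ^ r)\<close>. If it is nonzero, its
    coordinate at \<open>j\<close> cannot vanish, since the radical of \<open>\<mu>\<close> is
    trivial, and it can be scaled to 1.\<close>
  have normalized: "\<exists>x\<in>C. x $ j = 1 \<and> (\<forall>y\<in>C. ?B y x = (\<mu> j - c) * y $ j)"
    if "weighted_radical r n (\<mu>(j := c)) C \<noteq> {0\<^sub>v n}" for c
  proof -
    let ?R = "weighted_radical r n (\<mu>(j := c)) C"
    note R = vec_subspaceD[OF vec_subspace_radical[OF frob C, of "\<mu>(j := c)"]]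
    have "\<not> ?R \<subseteq> {0\<^sub>v n}"
      using that R(2) by (metis empty_iff subset_singletonD)
    then obtain z where z: "z \<in> ?R" "z \<noteq> 0\<^sub>v n" by auto
    have B: "?B y x = (\<mu> j - c) * (y $ j * (x $ j) ^ r)" if "x \<in> ?R" "y \<in> C" for x y
    proof -
      have "0 = (\<Sum>i<n. (\<mu>(j := c)) i * (y $ i * (x $ i) ^ r))"
        using that unfolding weighted_radical_def mult.assoc by (metis (mono_tags, lifting) mem_Collect_eq)
      also have "\<dots> = ?B y x + (c - \<mu> j) * (y $ j * (x $ j) ^ r)"
        by (simp only: weighted_sum_upd[OF j] mult.assoc)
      finally have "?B y x = - ((c - \<mu> j) * (y $ j * (x $ j) ^ r))"
        by (simp only: eq_neg_iff_add_eq_0)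
      then show ?thesis by (simp only: minus_diff_eq mult_minus_left[symmetric])
    qed
    have "z $ j \<noteq> 0"
    proof
      assume zj: "z $ j = 0"
      have "?B y z = 0" if "y \<in> C" for y
        unfolding B[OF z(1) that] using zj exponent_pos[OF frob] by simp
      then have "z \<in> weighted_radical r n \<mu> C"
        using z(1) unfolding weighted_radical_def by blast
      then show False using triv z(2) by simp
    qed
    define x where "x = inverse (z $ j) \<cdot>\<^sub>v z"
    have x: "x \<in> ?R" using R(4)[OF z(1)] by (simp add: x_def)
    have "z \<in> carrier_vec n" using z(1) R(1) by blast
    with \<open>z $ j \<noteq> 0\<close> j have x1: "x $ j = 1" by (simp add: x_def)
    have "x \<in> C" using x by (simp add: weighted_radical_def)
    moreover have "?B y x = (\<mu> j - c) * y $ j" if "y \<in> C" for y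
      unfolding B[OF x that] x1 by simp
    ultimately show ?thesis using x1 by blast
  qed
  assume "\<not> ?thesis"
  then have na: "weighted_radical r n (\<mu>(j := a)) C \<noteq> {0\<^sub>v n}"
    and nb: "weighted_radical r n (\<mu>(j := b)) C \<noteq> {0\<^sub>v n}" by simp_all
  obtain x where x: "x \<in> C" "x $ j = 1" "\<And>w. w \<in> C \<Longrightarrow> ?B w x = (\<mu> j - a) * w $ j"
    using normalized[OF na] by blast
  obtain y where y: "y \<in> C" "y $ j = 1" "\<And>w. w \<in> C \<Longrightarrow> ?B w y = (\<mu> j - b) * w $ j"
    using normalized[OF nb] by blast
  \<comment> \<open>With these roots \<open>s ^ r * (\<mu> j - a)\<close> equals
    \<open>t ^ r * (\<mu> j - b)\<close>, so \<open>?z\<close> below is in the radical of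
    \<open>\<mu>\<close> and vanishes. Its coordinate at \<open>j\<close> is \<open>s - t\<close>,
    and \<open>s = t\<close> forces \<open>a = b\<close>.\<close>
  obtain s t where s: "s ^ r = \<mu> j - b" and t: "t ^ r = \<mu> j - a"
    using ex_root_exponent[OF frob] by blast
  let ?z = "s \<cdot>\<^sub>v x - t \<cdot>\<^sub>v y"
  have cx: "x \<in> carrier_vec n" "y \<in> carrier_vec n" using x y CD(1) by auto
  have zC: "?z \<in> C" by (intro CD(4,5) x y)
  have "?B w ?z = 0" if "w \<in> C" for w
    using weighted_sum_diff[OF frob, of "s \<cdot>\<^sub>v x" n "t \<cdot>\<^sub>v y" "\<lambda>i. \<mu> i * w $ i"]
      weighted_sum_smult[OF cx(1), of "\<lambda>i. \<mu> i * w $ i" s]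
      weighted_sum_smult[OF cx(2), of "\<lambda>i. \<mu> i * w $ i" t] cx x(3)[OF that] y(3)[OF that] s t
    by (simp add: mult.commute)
  then have "?z \<in> weighted_radical r n \<mu> C" using zC unfolding weighted_radical_def by blast
  then have "?z = 0\<^sub>v n" using triv by simp
  then have "?z $ j = 0" using j by simp
  then have "s = t" using cx j x(2) y(2) by simp
  then show False using s t ab by simp
qed

text \<open>\<open>S\<close> plays the role of an information set: \<open>inj\<close> makes a
  codeword determined by its entries on \<open>S\<close>, and \<open>surj\<close> isolates each
  position of \<open>S\<close>. Starting from the indicator weights of \<open>S\<close>, the weights
  are moved into \<open>{a, b}\<close> one at a time while the radical stays trivial.\<close>

lemma ex_weights_radical_trivial:
  fixes C :: "'a::{field,finite} vec set"
  assumes frob: "\<And>x y :: 'a::{field,finite}. (x + y) ^ r = x ^ r + y ^ r"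
    and C: "vec_subspace n C" and S: "S \<subseteq> {..<n}"
    and inj: "\<And>x. x \<in> C \<Longrightarrow> \<forall>j\<in>S. x $ j = 0 \<Longrightarrow> x = 0\<^sub>v n"
    and surj: "\<And>j. j \<in> S \<Longrightarrow> \<exists>w\<in>C. w $ j \<noteq> 0 \<and> (\<forall>i\<in>S - {j}. w $ i = 0)"
    and ab: "a \<noteq> b"
  shows "\<exists>\<mu>. (\<forall>j<n. \<mu> j \<in> {a, b}) \<and> weighted_radical r n \<mu> C = {0\<^sub>v n}"
proof -
  have "\<exists>\<mu>. (\<forall>j<m. \<mu> j \<in> {a, b}) \<and> weighted_radical r n \<mu> C = {0\<^sub>v n}" if "m \<le> n" for m
    using that
  proof (induction m)
    case 0
    \<comment> \<open>Under these weights, pairing \<open>x\<close> with a word \<open>w\<close>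
      that is nonzero on \<open>S\<close> only at \<open>j\<close> leaves the single term
      \<open>w $ j * (x $ j) ^ r\<close>.\<close>
    define \<mu> :: "nat \<Rightarrow> 'a" where "\<mu> j = (if j \<in> S then 1 else 0)" for j
    have "x = 0\<^sub>v n" if x: "x \<in> weighted_radical r n \<mu> C" for x
    proof (rule inj)
      show "\<forall>j\<in>S. x $ j = 0"
      proof
        fix j assume j: "j \<in> S"
        then obtain w where w: "w \<in> C" "w $ j \<noteq> 0" "\<forall>i\<in>S - {j}. w $ i = 0"
          using surj by blast
        have "(\<Sum>i<n. \<mu> i * w $ i * (x $ i) ^ r) = (\<Sum>i\<in>{j}. \<mu> i * w $ i * (x $ i) ^ r)"
          using S j w by (intro sum.mono_neutral_right) (auto simp: \<mu>_def)
        then have "w $ j * (x $ j) ^ r = 0"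
          using x w j by (auto simp: weighted_radical_def \<mu>_def)
        then show "x $ j = 0" using w by simp
      qed
    qed (use x in \<open>simp add: weighted_radical_def\<close>)
    then have "weighted_radical r n \<mu> C = {0\<^sub>v n}"
      using vec_subspaceD(2)[OF vec_subspace_radical[OF frob C, of \<mu>]] by blast
    then show ?case by auto
  next
    case (Suc m)
    then obtain \<mu> where \<mu>: "\<forall>j<m. \<mu> j \<in> {a, b}" "weighted_radical r n \<mu> C = {0\<^sub>v n}" by auto
    have "\<forall>j<Suc m. (\<mu>(m := c)) j \<in> {a, b}" if "c \<in> {a, b}" for c
      using that \<mu>(1) by (auto simp: less_Suc_eq)
    moreover have "m < n" using Suc.prems by simp
    then obtain c where "c \<in> {a, b}" "weighted_radical r n (\<mu>(m := c)) C = {0\<^sub>v n}"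
      using radical_trivial_upd[OF frob C _ ab \<mu>(2)] by (meson insertCI)
    ultimately show ?case by blast
  qed
  then show ?thesis by blast
qed

lemma code_dim_radical_upd:
  fixes C :: "'a::{field,finite} vec set"
  assumes frob: "\<And>x y :: 'a::{field,finite}. (x + y) ^ r = x ^ r + y ^ r"
    and C: "vec_subspace n C" and j: "j < n"
  shows "code_dim n (weighted_radical r n \<mu> C)
    \<le> Suc (code_dim n (weighted_radical r n (\<mu>(j := c)) C))"
proof -
  have "card (UNIV :: 'a set) ^ code_dim n (weighted_radical r n \<mu> C)
    \<le> card (UNIV :: 'a set) ^ Suc (code_dim n (weighted_radical r n (\<mu>(j := c)) C))"
    using card_radical_upd[OF frob C j, of \<mu> c] card_vec_subspace[OF vec_subspace_radical[OF frob C]] by simp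
  then show ?thesis using one_less_card_field[where 'a='a] by (metis power_le_imp_le_exp)
qed

text \<open>A discrete intermediate value argument: passing coordinate by coordinate from the
  all-one weights to weights with trivial radical, the dimension drops by at most one per step and
  ends at 0.\<close>

lemma ex_weights_code_dim_radical:
  fixes C :: "'a::{field,finite} vec set"
  assumes frob: "\<And>x y :: 'a::{field,finite}. (x + y) ^ r = x ^ r + y ^ r"
    and C: "vec_subspace n C" and S: "S \<subseteq> {..<n}"
    and inj: "\<And>x. x \<in> C \<Longrightarrow> \<forall>j\<in>S. x $ j = 0 \<Longrightarrow> x = 0\<^sub>v n"
    and surj: "\<And>j. j \<in> S \<Longrightarrow> \<exists>w\<in>C. w $ j \<noteq> 0 \<and> (\<forall>i\<in>S - {j}. w $ i = 0)"
    and c: "c \<noteq> 1"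
    and s: "s \<le> code_dim n (weighted_radical r n (\<lambda>_. 1) C)"
  shows "\<exists>\<mu>. (\<forall>j. \<mu> j \<in> {1, c}) \<and> code_dim n (weighted_radical r n \<mu> C) = s"
proof -
  obtain \<nu> where \<nu>: "\<forall>j<n. \<nu> j \<in> {1, c}" "weighted_radical r n \<nu> C = {0\<^sub>v n}"
    using ex_weights_radical_trivial[OF frob C S inj surj, of 1 c] c by auto
  define \<mu> :: "nat \<Rightarrow> nat \<Rightarrow> 'a" where "\<mu> m j = (if j < m then \<nu> j else 1)" for m j
  define d where "d m = code_dim n (weighted_radical r n (\<mu> m) C)" for m
  have "d n = 0"
  proof -
    have "weighted_radical r n (\<mu> n) C = weighted_radical r n \<nu> C"
      by (simp add: weighted_radical_def \<mu>_def)
    then have "card (weighted_radical r n (\<mu> n) C) = 1" using \<nu> by simp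
    then show ?thesis unfolding d_def
      by (intro code_dim_eqI vec_subspace_radical[OF frob] C) simp
  qed
  have "\<mu> 0 = (\<lambda>_. 1)" by (auto simp: \<mu>_def)
  then have "s \<le> d 0" using s by (simp add: d_def)
  \<comment> \<open>The step after the last index with dimension at least \<open>s\<close> falls
    below \<open>s\<close>; a drop of at most one leaves equality. If \<open>m = n\<close>, the
    dimension is 0 and so is \<open>s\<close>.\<close>
  define m where "m = (GREATEST m. m \<le> n \<and> s \<le> d m)"
  have m: "m \<le> n \<and> s \<le> d m"
    unfolding m_def by (rule GreatestI_nat[where b = n and k = 0]) (use \<open>s \<le> d 0\<close> in auto)
  have "d m = s"
  proof (cases "m = n")
    case True
    then show ?thesis using m \<open>d n = 0\<close> by simp
  next
    case False
    then have "m < n" using m by simp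
    have "\<mu> (Suc m) = (\<mu> m)(m := \<nu> m)" by (auto simp: \<mu>_def fun_eq_iff)
    then have "d m \<le> Suc (d (Suc m))"
      using code_dim_radical_upd[OF frob C \<open>m < n\<close>, of "\<mu> m" "\<nu> m"] by (simp add: d_def)
    moreover have "\<not> s \<le> d (Suc m)"
    proof
      assume "s \<le> d (Suc m)"
      then have "Suc m \<le> (GREATEST m. m \<le> n \<and> s \<le> d m)"
        using \<open>m < n\<close> by (intro Greatest_le_nat[where b = n]) auto
      then have "Suc m \<le> m" by (simp flip: m_def)
      then show False by simp
    qed
    ultimately show ?thesis using m by simp
  qed
  moreover have "\<forall>j. \<mu> m j \<in> {1, c}" using \<nu>(1) m by (auto simp: \<mu>_def)
  ultimately show ?thesis unfolding d_def by blast
qed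

section \<open>Galois hulls as radicals, and rescaling of coordinates\<close>

lemma galois_hull_eq_weighted_radical:
  assumes "C \<subseteq> carrier_vec n"
  shows "galois_hull p e n C = weighted_radical (p ^ e) n (\<lambda>_. 1) C"
proof -
  have "galois_inner p e y x = (\<Sum>j<n. 1 * y $ j * (x $ j) ^ (p ^ e))" if "y \<in> C" for x y
    using that assms by (auto simp: galois_inner_def)
  then show ?thesis
    using assms unfolding galois_hull_def galois_dual_def weighted_radical_def by auto
qed

definition scale_vec :: "nat \<Rightarrow> (nat \<Rightarrow> 'a) \<Rightarrow> 'a::field vec \<Rightarrow> 'a vec" where
  "scale_vec n l x = vec n (\<lambda>j. l j * x $ j)"

lemma inj_on_scale_vec:
  assumes "\<And>j. j < n \<Longrightarrow> l j \<noteq> 0"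
  shows "inj_on (scale_vec n l) (carrier_vec n)"
proof (rule inj_onI)
  fix x y :: "'a vec"
  assume x: "x \<in> carrier_vec n" and y: "y \<in> carrier_vec n" and eq: "scale_vec n l x = scale_vec n l y"
  show "x = y"
  proof (rule eq_vecI)
    fix j assume "j < dim_vec y"
    with y have j: "j < n" by simp
    then have "scale_vec n l x $ j = l j * x $ j" "scale_vec n l y $ j = l j * y $ j"
      by (simp_all add: scale_vec_def)
    then show "x $ j = y $ j" using eq assms[OF j] by simp
  qed (use x y in simp)
qed

lemma vec_subspace_scale_vec:
  assumes C: "vec_subspace n C"
  shows "vec_subspace n (scale_vec n l ` C)"
proof (rule vec_subspaceI)
  note CD = vec_subspaceD[OF C]
  show "scale_vec n l ` C \<subseteq> carrier_vec n" by (auto simp: scale_vec_def)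
  have "0\<^sub>v n = scale_vec n l (0\<^sub>v n)" by (intro eq_vecI) (auto simp: scale_vec_def)
  then show "0\<^sub>v n \<in> scale_vec n l ` C" using CD(2) by blast
  show "x + y \<in> scale_vec n l ` C" if asm: "x \<in> scale_vec n l ` C" "y \<in> scale_vec n l ` C" for x y
  proof -
    obtain x' y' where xy: "x = scale_vec n l x'" "y = scale_vec n l y'" "x' \<in> C" "y' \<in> C"
      using asm by blast
    then have "x' \<in> carrier_vec n" "y' \<in> carrier_vec n" using CD(1) by auto
    then have "x + y = scale_vec n l (x' + y')"
      unfolding xy(1,2) by (intro eq_vecI) (auto simp: scale_vec_def distrib_left)
    then show ?thesis using CD(3)[OF xy(3,4)] by blast
  qed
  show "c \<cdot>\<^sub>v x \<in> scale_vec n l ` C" if asm: "x \<in> scale_vec n l ` C" for c x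
  proof -
    obtain x' where x: "x = scale_vec n l x'" "x' \<in> C"
      using asm by blast
    then have "x' \<in> carrier_vec n" using CD(1) by auto
    then have "c \<cdot>\<^sub>v x = scale_vec n l (c \<cdot>\<^sub>v x')"
      unfolding x(1) by (intro eq_vecI) (auto simp: scale_vec_def)
    then show ?thesis using CD(4)[OF x(2)] by blast
  qed
qed

lemma code_dim_scale_vec:
  fixes C :: "'a::{field,finite} vec set"
  assumes C: "vec_subspace n C" and l: "\<And>j. j < n \<Longrightarrow> l j \<noteq> 0"
  shows "code_dim n (scale_vec n l ` C) = code_dim n C"
proof (rule code_dim_eqI[OF vec_subspace_scale_vec[OF C]])
  have "inj_on (scale_vec n l) C"
    by (rule inj_on_subset[OF inj_on_scale_vec[OF l] vec_subspaceD(1)[OF C]])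
  then show "card (scale_vec n l ` C) = card (UNIV :: 'a set) ^ code_dim n C"
    using card_vec_subspace[OF C] by (simp add: card_image)
qed

text \<open>Both arguments are rescaled: \<open>y\<close> contributes \<open>l j\<close> and
  \<open>x\<close> contributes \<open>l j ^ r\<close>, whence the exponent
  \<open>r + 1\<close>.\<close>

lemma weighted_radical_scale_vec:
  "weighted_radical r n \<mu> (scale_vec n l ` C) =
    scale_vec n l ` weighted_radical r n (\<lambda>j. \<mu> j * l j ^ (r + 1)) C"
proof -
  have *: "(\<Sum>j<n. \<mu> j * scale_vec n l y $ j * (scale_vec n l x $ j) ^ r) =
    (\<Sum>j<n. (\<mu> j * l j ^ (r + 1)) * y $ j * (x $ j) ^ r)" for x y
    by (rule sum.cong) (simp_all add: scale_vec_def power_mult_distrib mult_ac)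
  show ?thesis unfolding weighted_radical_def by (auto simp: *)
qed

section \<open>Extended generalized Reed--Solomon codes\<close>

text \<open>The last coordinate is the evaluation at the point at infinity.\<close>

definition egrs_word ::
    "nat \<Rightarrow> nat \<Rightarrow> (nat \<Rightarrow> 'a) \<Rightarrow> (nat \<Rightarrow> 'a) \<Rightarrow> 'a::field poly \<Rightarrow> 'a vec" where
  "egrs_word N K a v f = vec N (\<lambda>j. v j * (if Suc j = N then Polynomial.coeff f (K - 1) else poly f (a j)))"

definition egrs_code :: "nat \<Rightarrow> nat \<Rightarrow> (nat \<Rightarrow> 'a) \<Rightarrow> (nat \<Rightarrow> 'a) \<Rightarrow> 'a::field vec set" where
  "egrs_code N K a v = egrs_word N K a v ` {f. degree f < K}"

lemma egrs_word_carrier [simp]: "egrs_word N K a v f \<in> carrier_vec N"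
  and dim_egrs_word [simp]: "dim_vec (egrs_word N K a v f) = N"
  by (simp_all add: egrs_word_def)

lemma egrs_word_diff: "egrs_word N K a v (f - g) = egrs_word N K a v f - egrs_word N K a v g"
  by (intro eq_vecI) (auto simp: egrs_word_def right_diff_distrib)

lemma egrs_word_0: "egrs_word N K a v 0 = 0\<^sub>v N"
  by (intro eq_vecI) (auto simp: egrs_word_def)

lemma vec_subspace_egrs_code:
  assumes "1 \<le> K"
  shows "vec_subspace N (egrs_code N K a v)"
proof (rule vec_subspaceI)
  show "egrs_code N K a v \<subseteq> carrier_vec N" by (auto simp: egrs_code_def)
  show "0\<^sub>v N \<in> egrs_code N K a v"
    unfolding egrs_code_def egrs_word_0[of N K a v, symmetric] using assms by (intro imageI) simp
  show "x + y \<in> egrs_code N K a v" if asm: "x \<in> egrs_code N K a v" "y \<in> egrs_code N K a v" for x y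
  proof -
    obtain f g where fg: "x = egrs_word N K a v f" "y = egrs_word N K a v g" "degree f < K" "degree g < K"
      using asm by (auto simp: egrs_code_def)
    have "x + y = egrs_word N K a v (f + g)"
      unfolding fg by (intro eq_vecI) (auto simp: egrs_word_def distrib_left)
    then show ?thesis
      unfolding egrs_code_def using fg degree_add_less by blast
  qed
  show "c \<cdot>\<^sub>v x \<in> egrs_code N K a v" if asm: "x \<in> egrs_code N K a v" for c x
  proof -
    obtain f where f: "x = egrs_word N K a v f" "degree f < K"
      using asm by (auto simp: egrs_code_def)
    have "c \<cdot>\<^sub>v x = egrs_word N K a v (Polynomial.smult c f)"
      unfolding f by (intro eq_vecI) (auto simp: egrs_word_def)
    then show ?thesis
      unfolding egrs_code_def using f degree_smult_le[of c f] by (intro image_eqI[of _ _ "Polynomial.smult c f"]) auto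
  qed
qed

lemma scale_vec_egrs_code:
  "scale_vec N l ` egrs_code N K a v = egrs_code N K a (\<lambda>j. l j * v j)"
proof -
  have "scale_vec N l (egrs_word N K a v f) = egrs_word N K a (\<lambda>j. l j * v j) f" for f
    by (intro eq_vecI) (auto simp: scale_vec_def egrs_word_def mult_ac)
  then show ?thesis by (simp add: egrs_code_def image_image)
qed

lemma card_poly_degree_less:
  assumes "1 \<le> K"
  shows "card {f :: 'a::{field,finite} poly. degree f < K} = card (UNIV :: 'a set) ^ K"
proof -
  have "bij_betw (\<lambda>f. map (Polynomial.coeff f) [0..<K]) {f :: 'a poly. degree f < K} {xs. length xs = K}"
  proof (rule bij_betw_byWitness[where f' = Poly])
    show "\<forall>f\<in>{f :: 'a poly. degree f < K}. Poly (map (Polynomial.coeff f) [0..<K]) = f"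
      by (auto simp: poly_eq_iff coeff_Poly_eq nth_default_def coeff_eq_0)
    show "\<forall>xs\<in>{xs :: 'a list. length xs = K}. map (Polynomial.coeff (Poly xs)) [0..<K] = xs"
      by (auto intro!: nth_equalityI simp: coeff_Poly_eq nth_default_def)
    show "Poly ` {xs :: 'a list. length xs = K} \<subseteq> {f. degree f < K}"
    proof clarify
      fix xs :: "'a list" assume "K = length xs"
      moreover have "degree (Poly xs) \<le> length xs - 1"
        by (rule degree_le) (auto simp: coeff_Poly_eq nth_default_def)
      ultimately show "degree (Poly xs) < length xs" using assms by simp
    qed
  qed auto
  then have "card {f :: 'a poly. degree f < K} = card {xs :: 'a list. length xs = K}"
    by (rule bij_betw_same_card)
  also have "\<dots> = card (UNIV :: 'a set) ^ K"
    using card_lists_length_eq[of "UNIV :: 'a set" K] by simp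
  finally show ?thesis .
qed

section \<open>Zeros of extended words and the MDS property\<close>

lemma poly_prod_linear_eq_0_iff:
  fixes a :: "'b \<Rightarrow> 'a::field"
  assumes "inj_on a A" "Z \<subseteq> A" "finite Z" "i \<in> A"
  shows "poly (\<Prod>j\<in>Z. [:- a j, 1:]) (a i) = 0 \<longleftrightarrow> i \<in> Z"
proof -
  have "poly (\<Prod>j\<in>Z. [:- a j, 1:]) (a i) = 0 \<longleftrightarrow> (\<exists>j\<in>Z. a i = a j)"
    using assms(3) by (auto simp: poly_prod)
  also have "\<dots> \<longleftrightarrow> i \<in> Z"
    using inj_onD[OF assms(1)] assms(2,4) by blast
  finally show ?thesis .
qed

text \<open>A zero at infinity means that the coefficient at \<open>K - 1\<close> vanishes, which
  lowers the degree bound by one and pays for the additional zero. Distinctness is asked below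
  \<open>N - 1\<close> because the last coordinate uses no finite point.\<close>

lemma card_zeros_egrs_word:
  fixes a v :: "nat \<Rightarrow> 'a::field"
  assumes K: "1 \<le> K" "K \<le> N" and inj: "inj_on a {..<N - 1}" and v: "\<forall>j<N. v j \<noteq> 0"
    and f: "degree f < K" "f \<noteq> 0"
  shows "card {j. j < N \<and> egrs_word N K a v f $ j = 0} < K"
proof -
  let ?A = "{j. j < N - 1 \<and> poly f (a j) = 0}"
  have zero_iff: "egrs_word N K a v f $ j = 0 \<longleftrightarrow>
      (if Suc j = N then Polynomial.coeff f (K - 1) = 0 else poly f (a j) = 0)" if "j < N" for j
    using that v by (auto simp: egrs_word_def)
  have "card ?A = card (a ` ?A)"
    using inj by (intro card_image[symmetric]) (auto simp: inj_on_def)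
  also have "\<dots> \<le> card {x. poly f x = 0}"
    using f(2) by (intro card_mono poly_roots_finite) auto
  also have "\<dots> \<le> degree f" using f(2) by (rule card_poly_roots_bound)
  finally have A: "card ?A \<le> degree f" .
  show ?thesis
  proof (cases "Polynomial.coeff f (K - 1) = 0")
    case True
    have "degree f \<noteq> K - 1" using True f(2) by (metis leading_coeff_neq_0)
    have "{j. j < N \<and> egrs_word N K a v f $ j = 0} \<subseteq> insert (N - 1) ?A"
      using zero_iff by auto
    then have "card {j. j < N \<and> egrs_word N K a v f $ j = 0} \<le> card (insert (N - 1) ?A)"
      by (intro card_mono) auto
    also have "\<dots> \<le> Suc (card ?A)" by (rule card_insert_le_m1[THEN le_trans]) auto
    finally show ?thesis using A \<open>degree f \<noteq> K - 1\<close> f(1) by simp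
  next
    case False
    then have "{j. j < N \<and> egrs_word N K a v f $ j = 0} \<subseteq> ?A"
      using zero_iff by (auto split: if_splits)
    then have "card {j. j < N \<and> egrs_word N K a v f $ j = 0} \<le> card ?A"
      by (intro card_mono) auto
    then show ?thesis using A f(1) by simp
  qed
qed

lemma inj_on_egrs_word:
  fixes a v :: "nat \<Rightarrow> 'a::field"
  assumes K: "1 \<le> K" "K \<le> N" and inj: "inj_on a {..<N - 1}" and v: "\<forall>j<N. v j \<noteq> 0"
  shows "inj_on (egrs_word N K a v) {f. degree f < K}"
proof (rule inj_onI, rule ccontr)
  fix f g assume *: "f \<in> {f. degree f < K}" "g \<in> {f. degree f < K}"
    "egrs_word N K a v f = egrs_word N K a v g" "f \<noteq> g"
  then have "egrs_word N K a v (f - g) = 0\<^sub>v N"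
    by (simp add: egrs_word_diff)
  then have "{j. j < N \<and> egrs_word N K a v (f - g) $ j = 0} = {..<N}" by auto
  then show False
    using card_zeros_egrs_word[OF K inj v, of "f - g"] degree_diff_less[of f K g] * K by simp
qed

text \<open>The product of linear factors at the finite points of \<open>Z\<close> has degree
  \<open>K - 1\<close> exactly when infinity is not in \<open>Z\<close>, so it also behaves
  correctly there. The exact zero set serves both the minimum distance and the isolation of one
  position of an information set.\<close>

lemma ex_egrs_word_zeros:
  fixes a v :: "nat \<Rightarrow> 'a::field"
  assumes K: "1 \<le> K" "K \<le> N" and inj: "inj_on a {..<N - 1}" and v: "\<forall>j<N. v j \<noteq> 0"
    and Z: "Z \<subseteq> {..<N}" "card Z = K - 1"
  shows "\<exists>x\<in>egrs_code N K a v. {j. j < N \<and> x $ j = 0} = Z"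
proof -
  define f where "f = (\<Prod>j\<in>Z - {N - 1}. [:- a j, 1:])"
  have finZ: "finite Z" using Z(1) finite_subset by blast
  have deg: "degree f = card (Z - {N - 1})"
    unfolding f_def by (subst degree_prod_eq_sum_degree) auto
  have lead: "lead_coeff f = 1" unfolding f_def by (simp add: lead_coeff_prod)
  have "degree f \<le> K - 1" unfolding deg using Z(2) finZ by (metis card_Diff1_le)
  then have degK: "degree f < K" using K by simp
  have inf: "Polynomial.coeff f (K - 1) = 0 \<longleftrightarrow> N - 1 \<in> Z"
  proof (cases "N - 1 \<in> Z")
    case True
    then have "degree f < K - 1" unfolding deg using Z(2) finZ by (metis card_Diff1_less)
    then show ?thesis using True by (simp add: coeff_eq_0)
  next
    case False
    then have "degree f = K - 1" using deg Z(2) by simp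
    then show ?thesis using False lead by simp
  qed
  have "Z - {N - 1} \<subseteq> {..<N - 1}" using Z(1) by fastforce
  then have fin: "poly f (a j) = 0 \<longleftrightarrow> j \<in> Z" if "j < N - 1" for j
    unfolding f_def using poly_prod_linear_eq_0_iff[OF inj, of "Z - {N - 1}" j] finZ that by simp
  have "egrs_word N K a v f $ j = 0 \<longleftrightarrow> j \<in> Z" if "j < N" for j
    using that v[rule_format, OF that] inf fin[of j] by (cases "Suc j = N") (auto simp: egrs_word_def)
  then have "{j. j < N \<and> egrs_word N K a v f $ j = 0} = Z" using Z(1) by auto
  then show ?thesis using degK unfolding egrs_code_def by blast
qed

lemma hamming_dist_egrs_word:
  "hamming_dist (egrs_word N K a v f) (egrs_word N K a v g) =
    N - card {j. j < N \<and> egrs_word N K a v (f - g) $ j = 0}"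
proof -
  have "{i. i < N \<and> egrs_word N K a v f $ i \<noteq> egrs_word N K a v g $ i} =
      {..<N} - {j. j < N \<and> egrs_word N K a v (f - g) $ j = 0}"
    by (auto simp: egrs_word_diff)
  then show ?thesis
    unfolding hamming_dist_def dim_egrs_word
    using card_Diff_subset[of "{j. j < N \<and> egrs_word N K a v (f - g) $ j = 0}" "{..<N}"] by auto
qed

lemma min_distance_egrs_code:
  fixes a v :: "nat \<Rightarrow> 'a::field"
  assumes K: "1 \<le> K" "K \<le> N" and inj: "inj_on a {..<N - 1}" and v: "\<forall>j<N. v j \<noteq> 0"
  shows "min_distance (egrs_code N K a v) = N - K + 1"
  unfolding min_distance_def
proof (rule Min_eqI)
  let ?D = "{hamming_dist x y |x y. x \<in> egrs_code N K a v \<and> y \<in> egrs_code N K a v \<and> x \<noteq> y}"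
  \<comment> \<open>The field may be infinite here; the set of distances is finite because each is
    at most \<open>N\<close>.\<close>
  have "?D \<subseteq> {..N}" by (auto simp: egrs_code_def hamming_dist_egrs_word)
  then show "finite ?D" by (rule finite_subset) simp
  show "N - K + 1 \<le> d" if "d \<in> ?D" for d
  proof -
    obtain f g where fg: "d = hamming_dist (egrs_word N K a v f) (egrs_word N K a v g)"
      "degree f < K" "degree g < K" "f \<noteq> g"
      using \<open>d \<in> ?D\<close> by (auto simp: egrs_code_def)
    then show ?thesis
      using card_zeros_egrs_word[OF K inj v, of "f - g"] degree_diff_less[of f K g] K
      by (simp add: hamming_dist_egrs_word)
  qed
  have Z: "{..<K - 1} \<subseteq> {..<N}" "card {..<K - 1} = K - 1" using K by auto
  obtain x where x: "x \<in> egrs_code N K a v" "{j. j < N \<and> x $ j = 0} = {..<K - 1}"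
    using ex_egrs_word_zeros[OF K inj v Z] by blast
  obtain f where f: "degree f < K" "{j. j < N \<and> egrs_word N K a v f $ j = 0} = {..<K - 1}"
    using x by (auto simp: egrs_code_def)
  have "f \<noteq> 0"
  proof
    assume "f = 0"
    then have "{j. j < N \<and> egrs_word N K a v f $ j = 0} = {..<N}" by (auto simp: egrs_word_0)
    then have "{..<N} = {..<K - 1}" using f(2) by simp
    then have "N = K - 1" by (metis card_lessThan)
    then show False using K by simp
  qed
  then have ne: "egrs_word N K a v f \<noteq> egrs_word N K a v 0"
    using inj_onD[OF inj_on_egrs_word[OF K inj v], of f 0] f(1) K by auto
  have "hamming_dist (egrs_word N K a v f) (egrs_word N K a v 0) = N - K + 1"
    unfolding hamming_dist_egrs_word using f(2) K by simp
  moreover have "egrs_word N K a v f \<in> egrs_code N K a v" "egrs_word N K a v 0 \<in> egrs_code N K a v"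
    using f(1) K by (auto simp: egrs_code_def)
  ultimately show "N - K + 1 \<in> ?D" using ne by (metis (mono_tags, lifting) mem_Collect_eq)
qed

lemma mds_egrs_code:
  fixes a v :: "nat \<Rightarrow> 'a::{field,finite}"
  assumes K: "1 \<le> K" "K \<le> N" and inj: "inj_on a {..<N - 1}" and v: "\<forall>j<N. v j \<noteq> 0"
  shows "mds_code N K (egrs_code N K a v)"
proof -
  have "card (egrs_code N K a v) = card (UNIV :: 'a set) ^ K"
    unfolding egrs_code_def
    using card_image[OF inj_on_egrs_word[OF K inj v]] card_poly_degree_less[OF K(1)] by simp
  then have "code_dim N (egrs_code N K a v) = K"
    by (rule code_dim_eqI[OF vec_subspace_egrs_code[OF K(1)]])
  then show ?thesis
    using min_distance_egrs_code[OF K inj v] vec_subspace_egrs_code[OF K(1)]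
    by (simp add: mds_code_def linear_code_def)
qed

text \<open>The weights 1 and \<open>b ^ (p ^ e + 1)\<close> arise from rescaling coordinates by 1
  or \<open>b\<close>, which only changes the multipliers \<open>v\<close>. Any \<open>K\<close>
  positions form an information set of such a code; the first \<open>K\<close> are taken.\<close>

lemma egrs_code_hull_variation:
  fixes a v :: "nat \<Rightarrow> 'a::{field,finite}"
  assumes frob: "\<And>x y :: 'a. (x + y) ^ (p ^ e) = x ^ (p ^ e) + y ^ (p ^ e)"
    and b: "(b :: 'a) \<noteq> 0" "b ^ (p ^ e + 1) \<noteq> 1"
    and K: "1 \<le> K" "K \<le> N" and inj: "inj_on a {..<N - 1}" and v: "\<forall>j<N. v j \<noteq> 0"
    and s: "s \<le> code_dim N (galois_hull p e N (egrs_code N K a v))"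
  shows "\<exists>w. (\<forall>j<N. w j \<noteq> 0) \<and> code_dim N (galois_hull p e N (egrs_code N K a w)) = s"
proof -
  let ?C = "egrs_code N K a v"
  have C: "vec_subspace N ?C" by (rule vec_subspace_egrs_code[OF K(1)])
  have hull: "galois_hull p e N (egrs_code N K a w) =
      weighted_radical (p ^ e) N (\<lambda>_. 1) (egrs_code N K a w)" for w
    by (rule galois_hull_eq_weighted_radical) (auto simp: egrs_code_def)
  have "\<exists>\<mu>. (\<forall>j. \<mu> j \<in> {1, b ^ (p ^ e + 1)}) \<and>
      code_dim N (weighted_radical (p ^ e) N \<mu> ?C) = s"
  proof (rule ex_weights_code_dim_radical[OF frob C _ _ _ b(2), where S = "{..<K}"])
    show "{..<K} \<subseteq> {..<N}" using K by auto
    show "x = 0\<^sub>v N" if x: "x \<in> ?C" "\<forall>j\<in>{..<K}. x $ j = 0" for x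
    proof -
      obtain f where f: "x = egrs_word N K a v f" "degree f < K"
        using x(1) by (auto simp: egrs_code_def)
      have "{..<K} \<subseteq> {j. j < N \<and> egrs_word N K a v f $ j = 0}" using x(2) f(1) K by auto
      then have "card {..<K} \<le> card {j. j < N \<and> egrs_word N K a v f $ j = 0}"
        by (intro card_mono) auto
      then have "f = 0" using card_zeros_egrs_word[OF K inj v f(2)] by fastforce
      then show ?thesis using f(1) by (simp add: egrs_word_0)
    qed
    show "\<exists>w\<in>?C. w $ j \<noteq> 0 \<and> (\<forall>i\<in>{..<K} - {j}. w $ i = 0)" if j: "j \<in> {..<K}" for j
    proof -
      have "{..<K} - {j} \<subseteq> {..<N}" "card ({..<K} - {j}) = K - 1" using K j by auto
      from ex_egrs_word_zeros[OF K inj v this]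
      obtain w where w: "w \<in> ?C" "{i. i < N \<and> w $ i = 0} = {..<K} - {j}" by blast
      have "j < N" using j K by simp
      then show ?thesis using w by blast
    qed
    show "s \<le> code_dim N (weighted_radical (p ^ e) N (\<lambda>_. 1) ?C)" using s hull by simp
  qed
  then obtain \<mu> where \<mu>: "\<And>j. \<mu> j \<in> {1, b ^ (p ^ e + 1)}"
    "code_dim N (weighted_radical (p ^ e) N \<mu> ?C) = s" by blast
  define l where "l j = (if \<mu> j = 1 then 1 else b)" for j
  have l0: "l j \<noteq> 0" for j using b by (simp add: l_def)
  have l: "1 * l j ^ (p ^ e + 1) = \<mu> j" for j
  proof (cases "\<mu> j = 1")
    case False
    then have "\<mu> j = b ^ (p ^ e + 1)" using \<mu>(1)[of j] by blast
    then show ?thesis using False by (simp only: l_def if_False mult_1_left)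
  qed (simp add: l_def)
  have "galois_hull p e N (egrs_code N K a (\<lambda>j. l j * v j)) =
      scale_vec N l ` weighted_radical (p ^ e) N \<mu> ?C"
    unfolding hull unfolding scale_vec_egrs_code[symmetric] weighted_radical_scale_vec l ..
  then have "code_dim N (galois_hull p e N (egrs_code N K a (\<lambda>j. l j * v j))) = s"
    using code_dim_scale_vec[OF vec_subspace_radical[OF frob C], of l] l0 \<mu>(2) by simp
  then show ?thesis using l0 v by (intro exI[of _ "\<lambda>j. l j * v j"]) auto
qed

section \<open>Lengthening a generalized Reed--Solomon code\<close>

lemma vec_subspace_grs:
  "vec_subspace n {vec n (\<lambda>j. v j * poly f (a j)) | f. degree f \<le> d}"
    (is "vec_subspace n ?C")
proof (rule vec_subspaceI)
  show "0\<^sub>v n \<in> ?C"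
    by (intro CollectI exI[of _ 0]) auto
  show "x + y \<in> ?C" if asm: "x \<in> ?C" "y \<in> ?C" for x y
  proof -
    obtain f g where "x = vec n (\<lambda>j. v j * poly f (a j))" "y = vec n (\<lambda>j. v j * poly g (a j))"
      "degree f \<le> d" "degree g \<le> d" using asm by blast
    then show ?thesis
      by (intro CollectI exI[of _ "f + g"]) (auto simp: distrib_left degree_add_le)
  qed
  show "c \<cdot>\<^sub>v x \<in> ?C" if asm: "x \<in> ?C" for c x
  proof -
    obtain f where f: "x = vec n (\<lambda>j. v j * poly f (a j))" "degree f \<le> d" using asm by blast
    have "degree (Polynomial.smult c f) \<le> d" using f(2) degree_smult_le[of c f] by linarith
    then show ?thesis using f(1)
      by (intro CollectI exI[of _ "Polynomial.smult c f"]) auto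
  qed
qed auto

text \<open>The first hypothesis guards against truncation of \<open>m - 1\<close>: for m = 0 the
  sum is empty, while a nonzero constant would pass the degree bound.\<close>

lemma poly_eq_sum_monom_less:
  assumes "m = 0 \<Longrightarrow> p = 0" "degree p \<le> m - 1"
  shows "p = (\<Sum>t<m. Polynomial.monom (Polynomial.coeff p t) t)"
proof (cases m)
  case (Suc m')
  then show ?thesis using assms(2) poly_as_sum_of_monoms'[of p m'] by (simp add: lessThan_Suc_atMost)
qed (use assms(1) in simp)

text \<open>A hull vector already pairs to zero with all \<open>g * h\<close>,
  \<open>degree h \<le> k - 1\<close>. These have codimension \<open>i\<close> among the polynomials
  of degree less than \<open>k + i\<close>, so \<open>i\<close> more equations place the padded
  vector in the new hull.\<close>

lemma code_dim_hull_extended: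
  fixes a v :: "nat \<Rightarrow> 'a::{field,finite}"
  assumes frob: "\<And>x y :: 'a. (x + y) ^ (p ^ e) = x ^ (p ^ e) + y ^ (p ^ e)"
    and k: "1 \<le> k" and i: "1 \<le> i"
    and inj: "inj_on a {..<n + i - 1}"
    and C: "C = {vec n (\<lambda>j. v j * poly f (a j)) | f. degree f \<le> k - 1}"
    and g: "g = (\<Prod>j\<in>{n..<n + i - 1}. [:- a j, 1:])"
    and u: "u = (\<lambda>j. if j < n then v j / poly g (a j) else 1)"
  shows "code_dim n (galois_hull p e n C) \<le>
    i + code_dim (n + i) (galois_hull p e (n + i) (egrs_code (n + i) (k + i) a u))"
proof -
  let ?q = "card (UNIV :: 'a set)"
  let ?D = "egrs_code (n + i) (k + i) a u"
  let ?H = "galois_hull p e n C"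
  have CV: "vec_subspace n C" unfolding C by (rule vec_subspace_grs)
  have DV: "vec_subspace (n + i) ?D" using k by (intro vec_subspace_egrs_code) simp
  note CD = vec_subspaceD[OF CV]
  have hullC: "?H = weighted_radical (p ^ e) n (\<lambda>_. 1) C"
    by (rule galois_hull_eq_weighted_radical[OF CD(1)])
  have hullD: "galois_hull p e (n + i) ?D = weighted_radical (p ^ e) (n + i) (\<lambda>_. 1) ?D"
    by (rule galois_hull_eq_weighted_radical[OF vec_subspaceD(1)[OF DV]])
  have HV: "vec_subspace n ?H" unfolding hullC by (rule vec_subspace_radical[OF frob CV])
  note HD = vec_subspaceD[OF HV]
  have degg: "degree g = i - 1" unfolding g by (subst degree_prod_eq_sum_degree) auto
  have g0: "g \<noteq> 0" unfolding g by auto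
  have new: "{n..<n + i - 1} \<subseteq> {..<n + i - 1}" by auto
  have g_root: "poly g (a j) = 0 \<longleftrightarrow> n \<le> j" if "j < n + i - 1" for j
    unfolding g using poly_prod_linear_eq_0_iff[OF inj new, of j] that by auto
  have g_new: "poly g (a j) = 0" if "n \<le> j" "j < n + i - 1" for j
    using g_root that by simp
  have g_old: "poly g (a j) \<noteq> 0" if "j < n" for j
    using g_root that i by simp
  \<comment> \<open>The pairing of the new word of \<open>f\<close> with the vector \<open>x\<close>
    padded by zeros; only the old coordinates contribute.\<close>
  define \<psi> where "\<psi> f x = (\<Sum>j<n. u j * poly f (a j) * (x $ j) ^ (p ^ e))" for f :: "'a poly" and x
  have \<psi>_add: "\<psi> (f + f') x = \<psi> f x + \<psi> f' x" for f f' x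
    by (simp add: \<psi>_def algebra_simps sum.distrib)
  have \<psi>_smult: "\<psi> (Polynomial.smult c f) x = c * \<psi> f x" for c f x
    by (simp add: \<psi>_def sum_distrib_left mult_ac)
  have \<psi>_sum: "\<psi> (\<Sum>t\<in>T. F t) x = (\<Sum>t\<in>T. \<psi> (F t) x)" if "finite T" for F x and T :: "nat set"
    using that by (induction T rule: finite_induct) (auto simp: \<psi>_add, simp add: \<psi>_def)
  have \<psi>_mult_g: "\<psi> (g * f) x = 0" if x: "x \<in> ?H" and f: "degree f \<le> k - 1" for f x
  proof -
    have "vec n (\<lambda>j. v j * poly f (a j)) \<in> C" unfolding C using f by blast
    then have "(\<Sum>j<n. 1 * vec n (\<lambda>j. v j * poly f (a j)) $ j * (x $ j) ^ (p ^ e)) = 0"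
      using x unfolding hullC weighted_radical_def by blast
    \<comment> \<open>At old points \<open>u j * poly g (a j) = v j\<close>, so \<open>g * f\<close>
      pairs with \<open>x\<close> as the word of \<open>f\<close> in \<open>C\<close> does.\<close>
    moreover have "\<psi> (g * f) x = (\<Sum>j<n. 1 * vec n (\<lambda>j. v j * poly f (a j)) $ j * (x $ j) ^ (p ^ e))"
      unfolding \<psi>_def using g_old by (intro sum.cong) (auto simp: u)
    ultimately show ?thesis by simp
  qed
  text \<open>\<open>g\<close> times polynomials of degree less than \<open>k\<close>, together with these \<open>i\<close> polynomials,
    span the polynomials of degree less than \<open>k + i\<close>.\<close>
  define P where "P t = (if t < i - 1 then Polynomial.monom 1 t else g * Polynomial.monom 1 k)" for t
  define H0 where "H0 = {x \<in> ?H. \<forall>t<i. \<psi> (P t) x = 0}"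
  have \<psi>_zero: "\<psi> f x = 0" if x: "x \<in> H0" and f: "degree f < k + i" for f x
  proof -
    have xH: "x \<in> ?H" and xP: "\<And>t. t < i \<Longrightarrow> \<psi> (P t) x = 0" using x by (auto simp: H0_def)
    \<comment> \<open>Division by \<open>g\<close> splits \<open>f\<close> into
      \<open>g * Q'\<close> with \<open>Q'\<close> of degree at most \<open>k - 1\<close>, a
      multiple of \<open>P (i - 1)\<close>, and a remainder spanned by the monomials
      \<open>P t\<close> with \<open>t < i - 1\<close>. Each piece pairs to zero with
      \<open>x\<close>.\<close>
    let ?Q = "f div g" and ?R = "f mod g"
    define Q' where "Q' = ?Q - Polynomial.monom (Polynomial.coeff ?Q k) k"
    \<comment> \<open>For i = 1 the polynomial \<open>g\<close> is 1 and no degree is below 0; the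
      alternative \<open>?R = 0\<close> covers this case.\<close>
    have R: "?R = 0 \<or> degree ?R < i - 1" using degree_mod_less[OF g0, of f] degg by simp
    then have "degree (f - ?R) < k + i" using f by (auto intro: degree_diff_less)
    then have "degree (g * ?Q) < k + i" by (simp add: minus_mod_eq_mult_div)
    then have Qk: "degree ?Q \<le> k"
      using degg g0 i by (cases "?Q = 0") (auto simp: degree_mult_eq)
    have "degree Q' \<le> k - 1"
    proof (rule degree_le, intro allI impI)
      fix t assume "k - 1 < t"
      then have "t = k \<or> k < t" using k by linarith
      then show "Polynomial.coeff Q' t = 0"
        using Qk by (auto simp: Q'_def coeff_eq_0)
    qed
    then have 1: "\<psi> (g * Q') x = 0" by (rule \<psi>_mult_g[OF xH])
    have "g * Polynomial.monom (Polynomial.coeff ?Q k) k =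
        Polynomial.smult (Polynomial.coeff ?Q k) (P (i - 1))"
      by (simp add: P_def smult_monom flip: mult_smult_right)
    then have 2: "\<psi> (g * Polynomial.monom (Polynomial.coeff ?Q k) k) x = 0"
      using xP[of "i - 1"] i by (simp add: \<psi>_smult)
    have "?R = (\<Sum>t<i - 1. Polynomial.monom (Polynomial.coeff ?R t) t)"
      using R by (intro poly_eq_sum_monom_less) auto
    also have "\<dots> = (\<Sum>t<i - 1. Polynomial.smult (Polynomial.coeff ?R t) (P t))"
      by (intro sum.cong) (auto simp: P_def smult_monom)
    finally have "\<psi> ?R x = (\<Sum>t<i - 1. Polynomial.coeff ?R t * \<psi> (P t) x)"
      by (metis (no_types, lifting) \<psi>_smult \<psi>_sum finite_lessThan sum.cong)
    also have "\<dots> = 0" by (intro sum.neutral) (auto intro: xP)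
    finally have 3: "\<psi> ?R x = 0" .
    have "f = g * Q' + g * Polynomial.monom (Polynomial.coeff ?Q k) k + ?R"
      by (simp add: Q'_def algebra_simps)
    then have "\<psi> f x = \<psi> (g * Q') x + \<psi> (g * Polynomial.monom (Polynomial.coeff ?Q k) k) x + \<psi> ?R x"
      by (metis \<psi>_add)
    then show ?thesis using 1 2 3 by simp
  qed
  define \<iota> where "\<iota> x = vec (n + i) (\<lambda>j. if j < n then x $ j else (0 :: 'a))" for x
  have \<iota>_hull: "\<iota> x \<in> galois_hull p e (n + i) ?D" if x: "x \<in> H0" for x
  proof -
    have "x \<in> C" using x by (simp add: H0_def galois_hull_def)
    then obtain f where f: "x = vec n (\<lambda>j. v j * poly f (a j))" "degree f \<le> k - 1"
      unfolding C by blast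
    \<comment> \<open>The bound is the index of the coefficient read at infinity, so the word of
      \<open>f * g\<close> is 0 there.\<close>
    have deg: "degree (f * g) < k + i - 1"
      using degree_mult_le[of f g] f(2) degg k i by linarith
    have "\<iota> x = egrs_word (n + i) (k + i) a u (f * g)"
    proof (rule eq_vecI)
      fix j assume "j < dim_vec (egrs_word (n + i) (k + i) a u (f * g))"
      then have j: "j < n + i" by simp
      consider "j < n" | "n \<le> j" "j < n + i - 1" | "Suc j = n + i" "n \<le> j" using j i by linarith
      then show "\<iota> x $ j = egrs_word (n + i) (k + i) a u (f * g) $ j"
      proof cases
        case 1
        then have "Suc j \<noteq> n + i" using i by simp
        then show ?thesis using 1 j g_old[OF 1] f(1) by (simp add: \<iota>_def egrs_word_def u)
      next
        case 2
        then show ?thesis using j g_new[OF 2] by (simp add: \<iota>_def egrs_word_def)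
      next
        case 3
        then show ?thesis using j deg by (simp add: \<iota>_def egrs_word_def coeff_eq_0)
      qed
    qed (simp add: \<iota>_def)
    then have D: "\<iota> x \<in> ?D" using deg by (auto simp: egrs_code_def)
    have "(\<Sum>j<n + i. 1 * y $ j * (\<iota> x $ j) ^ (p ^ e)) = 0" if y: "y \<in> ?D" for y
    proof -
      obtain h where h: "y = egrs_word (n + i) (k + i) a u h" "degree h < k + i"
        using y by (auto simp: egrs_code_def)
      \<comment> \<open>The padded coordinates drop out because
        \<open>0 ^ (p ^ e) = 0\<close>.\<close>
      have "(\<Sum>j<n + i. 1 * y $ j * (\<iota> x $ j) ^ (p ^ e)) = (\<Sum>j<n. 1 * y $ j * (\<iota> x $ j) ^ (p ^ e))"
        using exponent_pos[OF frob] by (intro sum.mono_neutral_right) (auto simp: \<iota>_def)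
      also have "\<dots> = \<psi> h x"
        unfolding \<psi>_def using i by (intro sum.cong) (auto simp: \<iota>_def h(1) egrs_word_def)
      finally show ?thesis using \<psi>_zero[OF x h(2)] by simp
    qed
    with D show ?thesis unfolding hullD weighted_radical_def by blast
  qed
  have "card ?H \<le> ?q ^ i * card H0"
    unfolding H0_def
  proof (rule card_le_card_common_kernel[OF HD(1) HD(5)])
    fix t x y assume xy: "x \<in> ?H" "y \<in> ?H"
    then show "\<psi> (P t) (x - y) = \<psi> (P t) x - \<psi> (P t) y"
      unfolding \<psi>_def using HD(1) by (intro weighted_sum_diff[OF frob]) auto
  qed
  also have "card H0 \<le> card (galois_hull p e (n + i) ?D)"
  proof (rule card_inj_on_le[where f = \<iota>])
    show "inj_on \<iota> H0"
    proof (rule inj_onI)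
      fix x y assume xy: "x \<in> H0" "y \<in> H0" "\<iota> x = \<iota> y"
      then have "x \<in> carrier_vec n" "y \<in> carrier_vec n" using HD(1) by (auto simp: H0_def)
      moreover have "x $ j = y $ j" if "j < n" for j
        using arg_cong[OF xy(3), of "\<lambda>w. w $ j"] that by (simp add: \<iota>_def)
      ultimately show "x = y" by (intro eq_vecI) auto
    qed
    show "\<iota> ` H0 \<subseteq> galois_hull p e (n + i) ?D" using \<iota>_hull by blast
    show "finite (galois_hull p e (n + i) ?D)"
      unfolding hullD
      by (rule finite_vec_subspace[OF vec_subspaceD(1)[OF vec_subspace_radical[OF frob DV]]])
  qed
  also have "\<dots> = ?q ^ code_dim (n + i) (galois_hull p e (n + i) ?D)"
    unfolding hullD by (rule card_vec_subspace[OF vec_subspace_radical[OF frob DV]])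
  also have "?q ^ i * \<dots> = ?q ^ (i + code_dim (n + i) (galois_hull p e (n + i) ?D))"
    by (simp add: power_add)
  finally have "?q ^ code_dim n ?H \<le> ?q ^ (i + code_dim (n + i) (galois_hull p e (n + i) ?D))"
    using card_vec_subspace[OF HV] by simp
  then show ?thesis
    by (rule power_le_imp_le_exp[OF one_less_card_field])
qed

section \<open>New evaluation points and a suitable scalar in a finite field\<close>

lemma inj_on_extend:
  fixes a :: "nat \<Rightarrow> 'a::finite"
  assumes "inj_on a {..<n}" "n \<le> N" "N \<le> card (UNIV :: 'a set)"
  shows "\<exists>b. inj_on b {..<N} \<and> (\<forall>j<n. b j = a j)"
  using assms(2,3)
proof (induction N rule: dec_induct)
  case (step N)
  then obtain b where b: "inj_on b {..<N}" "\<forall>j<n. b j = a j" by auto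
  have "card (b ` {..<N}) = N" using b(1) by (simp add: card_image)
  then have "b ` {..<N} \<noteq> UNIV" using step.prems by auto
  then obtain x where "x \<notin> b ` {..<N}" by blast
  then have "inj_on (b(N := x)) {..<Suc N}"
    using b(1) by (auto simp: lessThan_Suc inj_on_def)
  moreover have "\<forall>j<n. (b(N := x)) j = a j" using b(2) step.hyps by simp
  ultimately show ?case by blast
qed (use assms(1) in auto)

lemma CHAR_eq_of_card:
  assumes "prime p" "card (UNIV :: 'a::{field,finite} set) = p ^ m"
  shows "CHAR('a) = p"
proof -
  have "prime CHAR('a)" using finite_imp_CHAR_pos[where 'a='a] prime_CHAR_semidom[where 'a='a] by simp
  moreover have "CHAR('a) dvd p ^ m" using CHAR_dvd_CARD[where 'a='a] assms(2) by simp
  ultimately show ?thesis using assms(1) prime_dvd_power primes_dvd_imp_eq by blast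
qed

text \<open>Otherwise all q - 1 nonzero elements are roots of a polynomial of degree
  \<open>p ^ e + 1\<close>, so q is at most \<open>p ^ (m - 1) + 2\<close>. As q is at least twice
  \<open>p ^ (m - 1)\<close>, that power is at most 2 and q at most 4.\<close>

lemma ex_power_Suc_neq_one:
  assumes p: "prime p" and card: "card (UNIV :: 'a::{field,finite} set) = p ^ m"
    and gt: "p ^ m > (4 :: nat)" and e: "e \<le> m - 1"
  shows "\<exists>b :: 'a. b \<noteq> 0 \<and> b ^ (p ^ e + 1) \<noteq> 1"
proof (rule ccontr)
  assume "\<not> ?thesis"
  then have roots: "b ^ (p ^ e + 1) = 1" if "b \<noteq> 0" for b :: 'a using that by blast
  let ?f = "Polynomial.monom 1 (p ^ e + 1) - 1 :: 'a poly"
  have coeff: "Polynomial.coeff ?f (p ^ e + 1) = 1" by simp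
  then have f0: "?f \<noteq> 0" by (metis coeff_0 zero_neq_one)
  have "degree ?f \<le> p ^ e + 1"
    by (rule degree_diff_le) (simp_all add: degree_monom_le)
  have "UNIV - {0} \<subseteq> {x. poly ?f x = 0}"
    using roots by (auto simp: poly_monom)
  then have "card (UNIV - {0 :: 'a}) \<le> card {x. poly ?f x = 0}"
    by (intro card_mono poly_roots_finite f0)
  also have "\<dots> \<le> p ^ e + 1"
    using card_poly_roots_bound[OF f0] \<open>degree ?f \<le> p ^ e + 1\<close> by linarith
  finally have le: "p ^ m - 1 \<le> p ^ e + 1" using card by (simp add: card_Diff_subset)
  have p2: "2 \<le> p" using p by (rule prime_ge_2_nat)
  have "m \<noteq> 0" using gt by (intro notI) simp
  then obtain m' where m': "m = Suc m'" by (cases m) auto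
  have "p ^ e \<le> p ^ m'" using e m' p2 by (intro power_increasing) auto
  then have le': "p * p ^ m' \<le> p ^ m' + 2" using le m' by simp
  have "2 * p ^ m' \<le> p * p ^ m'" using p2 by simp
  then have "p ^ m' \<le> 2" using le' by linarith
  then have "p * p ^ m' \<le> 4" using le' by linarith
  then show False using gt m' by simp
qed

theorem corollary9:
  fixes p m q e n k l :: nat
  assumes "prime p"
    and "q = p ^ m"
    and "q > 4"
    and "card (UNIV :: 'a::{field,finite} set) = q"
    and "0 \<le> e" and "e \<le> m - 1"
    and "0 \<le> l" and "l \<le> k"
    and "\<exists>C :: 'a vec set. grs_code n k C \<and> code_dim n (galois_hull p e n C) = l"
  shows "\<forall>i s. 1 \<le> i \<and> i \<le> min l (q + 1 - n) \<and> 0 \<le> s \<and> s \<le> l - i \<longrightarrow>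
    (\<exists>D :: 'a vec set. mds_code (n + i) (k + i) D \<and>
       code_dim (n + i) (galois_hull p e (n + i) D) = s)"
proof (intro allI impI)
  fix i s
  assume bounds: "1 \<le> i \<and> i \<le> min l (q + 1 - n) \<and> 0 \<le> s \<and> s \<le> l - i"
  have card: "card (UNIV :: 'a set) = p ^ m" using assms(2,4) by simp
  have frob: "(x + y) ^ (p ^ e) = x ^ (p ^ e) + y ^ (p ^ e)" for x y :: 'a
    using freshmans_dream'[where 'a='a] CHAR_eq_of_card[OF assms(1) card] assms(1) by simp
  obtain b :: 'a where b: "b \<noteq> 0" "b ^ (p ^ e + 1) \<noteq> 1"
    using ex_power_Suc_neq_one[OF assms(1) card] assms(2,3,6) by blast
  obtain C :: "'a vec set" where C: "grs_code n k C" "code_dim n (galois_hull p e n C) = l"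
    using assms(9) by blast
  from C(1) obtain a v where k: "1 \<le> k" "k \<le> n" and a: "inj_on a {..<n}" and v: "\<forall>j<n. v j \<noteq> 0"
    and C_eq: "C = {vec n (\<lambda>j. v j * poly f (a j)) | f. degree f \<le> k - 1}"
    unfolding grs_code_def by blast
  \<comment> \<open>One of the \<open>i\<close> new coordinates is at infinity, so
    \<open>i - 1\<close> new finite points suffice. Since \<open>1 \<le> i\<close>, the difference
    \<open>q + 1 - n\<close> is not truncated and its bound on \<open>i\<close> leaves room for
    them.\<close>
  have "n + i - 1 \<le> card (UNIV :: 'a set)" using bounds assms(4) by auto
  then obtain a' where a': "inj_on a' {..<n + i - 1}" "\<forall>j<n. a' j = a j"
    using inj_on_extend[OF a _ \<open>n + i - 1 \<le> _\<close>] bounds by (metis Nat.add_diff_assoc le_add1)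
  have "vec n (\<lambda>j. v j * poly f (a j)) = vec n (\<lambda>j. v j * poly f (a' j))" for f
    using a'(2) by (intro eq_vecI) auto
  then have C_eq': "C = {vec n (\<lambda>j. v j * poly f (a' j)) | f. degree f \<le> k - 1}"
    unfolding C_eq by simp
  define g where "g = (\<Prod>j\<in>{n..<n + i - 1}. [:- a' j, 1:])"
  define u where "u = (\<lambda>j. if j < n then v j / poly g (a' j) else 1)"
  \<comment> \<open>The new hull has dimension at least \<open>l - i\<close>, hence at least
    \<open>s\<close>.\<close>
  have s: "s \<le> code_dim (n + i) (galois_hull p e (n + i) (egrs_code (n + i) (k + i) a' u))"
    using code_dim_hull_extended[OF frob k(1) _ a'(1) C_eq' g_def u_def] bounds C(2) by auto
  have new: "{n..<n + i - 1} \<subseteq> {..<n + i - 1}" by auto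
  have "poly g (a' j) \<noteq> 0" if "j < n" for j
  proof -
    have "j < n + i - 1" using that bounds by linarith
    then show ?thesis
      unfolding g_def using poly_prod_linear_eq_0_iff[OF a'(1) new, of j] that by simp
  qed
  with v have u: "\<forall>j<n + i. u j \<noteq> 0" by (simp add: u_def)
  \<comment> \<open>Only the multipliers change from \<open>u\<close> to \<open>w\<close>, so the
    code is still extended GRS and hence MDS.\<close>
  obtain w where w: "\<forall>j<n + i. w j \<noteq> 0"
    "code_dim (n + i) (galois_hull p e (n + i) (egrs_code (n + i) (k + i) a' w)) = s"
    using egrs_code_hull_variation[OF frob b _ _ a'(1) u s] k by auto
  moreover have "mds_code (n + i) (k + i) (egrs_code (n + i) (k + i) a' w)"
    using k a'(1) w(1) by (intro mds_egrs_code) auto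
  ultimately show "\<exists>D :: 'a vec set. mds_code (n + i) (k + i) D \<and>
      code_dim (n + i) (galois_hull p e (n + i) D) = s" by blast
qed

end
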